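(* Let $\mathbb{F}$ be a field, $E=\mathbb{F}^n$, and let $G=(E,\mathcal{F})$ be a $q$-$g$-matroid. Then $(E,\mathcal{F})$ is a $q$-$\Delta$-matroid.
   Context: $E=\mathbb{F}^n$ is a finite-dimensional vector space over a field $\mathbb{F}$. A $q$-matroid on $E$ is a pair $M=(E,r)$ with $r$ an integer-valued function on the subspaces of $E$ such that (R1) $0\le r(A)\le\dim A$ for every subspace $A$; (R2) $r(A)\le r(B)$ whenever $A\subseteq B$; (R3) $r(A+B)+r(A\cap B)\le r(A)+r(B)$ for all subspaces $A,B$. A subspace $A$ is independent if $r(A)=\dim A$, spanning if $r(A)=r(E)$, and a flat if $r(A+x)>r(A)$ for every $1$-dimensional subspace $x\not\subseteq A$. For $q$-matroids $M_1,M_2$ on the same ground space $E$, the identity $Id:M_1\to M_2$ is a strong map if every flat of $M_2$ is a flat of $M_1$. A $q$-$g$-matroid is a pair $(E,\mathcal{F})$ for which there exist $q$-matroids $M_1,M_2$ on $E$ such that $Id:M_1\to M_2$ is a strong map and $\mathcal{F}$ is the set of all subspaces of $E$ that are independent in $M_1$ and spanning in $M_2$. A $q$-$\Delta$-matroid is a pair $(E,\mathcal{F})$ with $\mathcal{F}$ a non-empty family of subspaces of $E$ satisfying: (F1) For all $X,Y\in\mathcal{F}$ and each subspace $A$ of codimension $1$ in $X$, either (i) there is a codimension-$1$ subspace $Z\subseteq E$ with $A\subseteq Z$, $Y\not\subseteq Z$, such that $A+z\in\mathcal{F}$ for all $1$-dimensional $z\subseteq E$ with $z\not\subseteq Z$;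 or (ii) there is a codimension-$1$ subspace $Z\subseteq E$ such that $Z\cap A\in\mathcal{F}$. (F2) For all $X,Y\in\mathcal{F}$ and each subspace $A\subseteq E$ in which $X$ has codimension $1$, either (iii) there is a $1$-dimensional $z\subseteq A$, $z\not\subseteq Y$, such that $A\cap Z\in\mathcal{F}$ for every codimension-$1$ subspace $Z\subseteq E$ with $z\not\subseteq Z$; or (iv) there is a $1$-dimensional $z\subseteq E$ such that $A+z\in\mathcal{F}$. *)

theory Defs
  imports Main HOL.Vector_Spaces "HOL-Library.Set_Algebras"
begin

text \<open>
  The ground space \<open>E\<close> is the whole type \<open>'b\<close>, viewed as a vector space over \<open>'a\<close> via \<open>scale\<close>,
  so the pairs \<open>(E, r)\<close> and \<open>(E, \<F>)\<close> are represented by \<open>r\<close> and \<open>\<F>\<close> alone. The values of a rank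
  function on sets that are not subspaces are irrelevant. The sum \<open>A + B\<close> of subspaces is the
  elementwise sum of sets from \<open>Set_Algebras\<close>.
\<close>

context vector_space
begin

definition line :: "'b set \<Rightarrow> bool" where
  "line x \<longleftrightarrow> subspace x \<and> dim x = 1"

definition codim1_in :: "'b set \<Rightarrow> 'b set \<Rightarrow> bool" where
  "codim1_in A X \<longleftrightarrow> subspace A \<and> subspace X \<and> A \<subseteq> X \<and> dim X = dim A + 1"

definition q_matroid :: "('b set \<Rightarrow> int) \<Rightarrow> bool" where
  "q_matroid r \<longleftrightarrow>
     (\<forall>A. subspace A \<longrightarrow> 0 \<le> r A \<and> r A \<le> int (dim A)) \<and>
     (\<forall>A B. subspace A \<longrightarrow> subspace B \<longrightarrow> A \<subseteq> B \<longrightarrow> r A \<le> r B) \<and>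
     (\<forall>A B. subspace A \<longrightarrow> subspace B \<longrightarrow> r (A + B) + r (A \<inter> B) \<le> r A + r B)"

definition q_independent :: "('b set \<Rightarrow> int) \<Rightarrow> 'b set \<Rightarrow> bool" where
  "q_independent r A \<longleftrightarrow> subspace A \<and> r A = int (dim A)"

definition q_spanning :: "('b set \<Rightarrow> int) \<Rightarrow> 'b set \<Rightarrow> bool" where
  "q_spanning r A \<longleftrightarrow> subspace A \<and> r A = r UNIV"

definition q_flat :: "('b set \<Rightarrow> int) \<Rightarrow> 'b set \<Rightarrow> bool" where
  "q_flat r A \<longleftrightarrow> subspace A \<and> (\<forall>x. line x \<longrightarrow> \<not> x \<subseteq> A \<longrightarrow> r (A + x) > r A)"

definition id_strong_map :: "('b set \<Rightarrow> int) \<Rightarrow> ('b set \<Rightarrow> int) \<Rightarrow> bool" where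
  "id_strong_map r1 r2 \<longleftrightarrow> (\<forall>A. q_flat r2 A \<longrightarrow> q_flat r1 A)"

definition q_g_matroid :: "'b set set \<Rightarrow> bool" where
  "q_g_matroid \<F> \<longleftrightarrow>
     (\<exists>r1 r2. q_matroid r1 \<and> q_matroid r2 \<and> id_strong_map r1 r2 \<and>
        \<F> = {A. q_independent r1 A \<and> q_spanning r2 A})"

definition q_delta_F1 :: "'b set set \<Rightarrow> bool" where
  "q_delta_F1 \<F> \<longleftrightarrow>
     (\<forall>X\<in>\<F>. \<forall>Y\<in>\<F>. \<forall>A. codim1_in A X \<longrightarrow>
        (\<exists>Z. codim1_in Z UNIV \<and> A \<subseteq> Z \<and> \<not> Y \<subseteq> Z \<and>
           (\<forall>z. line z \<longrightarrow> \<not> z \<subseteq> Z \<longrightarrow> A + z \<in> \<F>)) \<or>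
        (\<exists>Z. codim1_in Z UNIV \<and> Z \<inter> A \<in> \<F>))"

definition q_delta_F2 :: "'b set set \<Rightarrow> bool" where
  "q_delta_F2 \<F> \<longleftrightarrow>
     (\<forall>X\<in>\<F>. \<forall>Y\<in>\<F>. \<forall>A. codim1_in X A \<longrightarrow>
        (\<exists>z. line z \<and> z \<subseteq> A \<and> \<not> z \<subseteq> Y \<and>
           (\<forall>Z. codim1_in Z UNIV \<longrightarrow> \<not> z \<subseteq> Z \<longrightarrow> A \<inter> Z \<in> \<F>)) \<or>
        (\<exists>z. line z \<and> A + z \<in> \<F>))"

definition q_delta_matroid :: "'b set set \<Rightarrow> bool" where
  "q_delta_matroid \<F> \<longleftrightarrow>
     \<F> \<noteq> {} \<and> (\<forall>X\<in>\<F>. subspace X) \<and> q_delta_F1 \<F> \<and> q_delta_F2 \<F>"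

end

end

theory Submission
  imports Defs
begin

text \<open>
  For a strong map the rank increments of \<open>M\<^sub>2\<close> are at most those of \<open>M\<^sub>1\<close>. In (F1), if \<open>A\<close> is not
  itself feasible, then its closure in \<open>M\<^sub>2\<close> is proper and does not contain \<open>Y\<close>, and any hyperplane
  \<open>Z\<close> through the closure missing a point of \<open>Y\<close> works. In (F2), if \<open>A\<close> is not itself
  feasible, then it has nullity \<open>1\<close> in \<open>M\<^sub>1\<close> and contains a circuit \<open>D\<close>; the circuit is not contained
  in \<open>Y\<close>, any line of \<open>D\<close> outside \<open>Y\<close> works, because hyperplanes of \<open>A\<close> not containing \<open>D\<close> are
  independent.
\<close>

context vector_space
begin

section \<open>Sums of subspaces\<close>

lemma set_plus_eq_sums: "A + B = {x + y |x y. x \<in> A \<and> y \<in> B}" for A B :: "'b set"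
  by (auto simp: set_plus_def)

lemma subspace_plus:
  assumes "subspace A" "subspace B"
  shows "subspace (A + B)"
  using subspace_sums[OF assms] by (simp add: set_plus_eq_sums)

lemma subset_plus_left:
  assumes "subspace B"
  shows "A \<subseteq> A + B"
  using set_zero_plus2[OF subspace_0[OF assms]] by (simp add: add.commute)

lemma subset_plus_right:
  assumes "subspace A"
  shows "B \<subseteq> A + B"
  using set_zero_plus2[OF subspace_0[OF assms]] .

lemma plus_subset_subspace:
  assumes "subspace C" "A \<subseteq> C" "B \<subseteq> C"
  shows "A + B \<subseteq> C"
  using assms by (auto simp: set_plus_def intro: subspace_add)

lemma plus_absorb:
  assumes "subspace A" "subspace B" "B \<subseteq> A"
  shows "A + B = A"
  using assms by (simp add: plus_subset_subspace subset_plus_left subset_antisym)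

lemma plus_span_singleton:
  assumes "subspace A"
  shows "A + span {x} = span (insert x A)"
proof -
  have "span A = A"
    using assms by simp
  then show ?thesis
    using span_Un[of A "{x}"] by (simp only: set_plus_eq_sums Un_insert_right sup_bot_right)
qed

section \<open>Elementary properties of the rank function\<close>

lemma q_matroid_bounds:
  assumes "q_matroid r" "subspace A"
  shows "0 \<le> r A" "r A \<le> int (dim A)"
  using assms by (auto simp: q_matroid_def)

lemma q_matroid_mono:
  assumes "q_matroid r" "subspace A" "subspace B" "A \<subseteq> B"
  shows "r A \<le> r B"
  using assms unfolding q_matroid_def by blast

lemma q_matroid_submodular:
  assumes "q_matroid r" "subspace A" "subspace B"
  shows "r (A + B) + r (A \<inter> B) \<le> r A + r B"
  using assms unfolding q_matroid_def by blast

text \<open>Submodularity for \<open>F\<close> and \<open>A + z\<close>: their sum is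
  \<open>F + z\<close> and their intersection contains \<open>A\<close>.\<close>

lemma q_matroid_increment_antimono:
  assumes "q_matroid r" "subspace A" "subspace F" "subspace z" "A \<subseteq> F"
  shows "r (F + z) - r F \<le> r (A + z) - r A"
proof -
  have Az: "subspace (A + z)"
    using assms by (simp add: subspace_plus)
  have "F + (A + z) = F + z"
    using plus_absorb[OF assms(3,2,5)] by (simp add: add.assoc[symmetric])
  then have "r (F + z) + r (F \<inter> (A + z)) \<le> r F + r (A + z)"
    using q_matroid_submodular[OF assms(1,3) Az] by simp
  moreover have "r A \<le> r (F \<inter> (A + z))"
    using assms Az subset_plus_left[OF assms(4), of A]
    by (intro q_matroid_mono) (auto simp: subspace_inter)
  ultimately show ?thesis by simp
qed

end

context finite_dimensional_vector_space
begin

section \<open>Dimension, lines and hyperplanes\<close>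

lemma dim_plus_Int:
  assumes "subspace A" "subspace B"
  shows "dim (A + B) + dim (A \<inter> B) = dim A + dim B"
  using dim_sums_Int[OF assms] by (simp add: set_plus_eq_sums)

lemma line_span_singleton:
  assumes "x \<noteq> 0"
  shows "line (span {x})"
  using assms by (simp add: line_def dim_insert)

lemma lineE:
  assumes "line z"
  obtains x where "x \<noteq> 0" "z = span {x}"
proof -
  have z: "subspace z" "dim z = 1"
    using assms by (auto simp: line_def)
  then have "\<not> z \<subseteq> {0}"
    using dim_eq_0[of z] by simp
  then obtain x where x: "x \<in> z" "x \<noteq> 0"
    by blast
  have "span {x} = z"
    using x z line_span_singleton[OF x(2)]
    by (intro subspace_dim_equal span_minimal) (auto simp: line_def)
  then show ?thesis
    using that x by blast
qed

lemma dim_plus_line: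
  assumes "subspace A" "line z" "\<not> z \<subseteq> A"
  shows "dim (A + z) = dim A + 1"
proof -
  obtain x where x: "z = span {x}"
    using lineE[OF assms(2)] by blast
  then have "x \<notin> A"
    using assms span_minimal[of "{x}" A] by blast
  moreover have "span A = A"
    using assms by simp
  ultimately show ?thesis
    using x by (simp only: plus_span_singleton[OF assms(1)] dim_span dim_insert if_False)
qed

text \<open>Dimensions are bounded by \<open>dim UNIV\<close>. Hyperplanes, closures and bases are
  all obtained as maximal choices of this kind.\<close>

lemma ex_max_dim:
  assumes "P A"
  shows "\<exists>F. P F \<and> (\<forall>G. P G \<longrightarrow> dim G \<le> dim F)"
proof -
  have "\<forall>G. P G \<longrightarrow> dim G < dim UNIV + 1"
    using dim_subset[OF subset_UNIV] by (metis less_add_one order_le_less_trans)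
  from ex_has_greatest_nat[OF assms this] show ?thesis .
qed

text \<open>\<open>B\<close> is reached from \<open>A\<close> by adding one line of \<open>B\<close>
  at a time, so monotonicity need only be checked on extensions by a line. This serves for the
  nullity and for the difference of two rank functions.\<close>

lemma subspace_chain_mono:
  fixes f :: "'b set \<Rightarrow> int"
  assumes step: "\<And>C z. subspace C \<Longrightarrow> line z \<Longrightarrow> \<not> z \<subseteq> C \<Longrightarrow> f C \<le> f (C + z)"
    and "subspace A" "subspace B" "A \<subseteq> B"
  shows "f A \<le> f B"
  using assms(2-)
proof (induction "dim B - dim A" arbitrary: A rule: less_induct)
  case less
  show ?case
  proof (cases "A = B")
    case False
    then obtain x where x: "x \<in> B" "x \<notin> A"
      using less.prems by blast
    then have z: "line (span {x})" "\<not> span {x} \<subseteq> A"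
      using less.prems subspace_0 span_base[of x "{x}"] by (auto intro!: line_span_singleton)
    have sub: "subspace (A + span {x})"
      using less.prems by (simp add: subspace_plus)
    have le: "A + span {x} \<subseteq> B"
      using less.prems x by (simp add: plus_subset_subspace span_minimal)
    have "dim (A + span {x}) = dim A + 1" "dim (A + span {x}) \<le> dim B"
      using dim_plus_line[OF _ z] dim_subset[OF le] less.prems by auto
    then have "f (A + span {x}) \<le> f B"
      using less.prems sub le by (intro less.hyps) auto
    then show ?thesis
      using step[OF _ z] less.prems by force
  qed simp
qed

text \<open>A largest subspace \<open>Z\<close> that contains \<open>V\<close> and misses
  \<open>y\<close> is a hyperplane: enlarging it by any outside \<open>w\<close> must capture
  \<open>y\<close>, and by exchange \<open>w\<close> then lies in the span of \<open>Z\<close> and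
  \<open>y\<close>.\<close>

lemma ex_hyperplane_avoiding:
  assumes "subspace V" "y \<notin> V"
  obtains Z where "codim1_in Z UNIV" "V \<subseteq> Z" "y \<notin> Z"
proof -
  obtain Z where Z: "subspace Z" "V \<subseteq> Z" "y \<notin> Z"
    and max: "\<And>G. subspace G \<and> V \<subseteq> G \<and> y \<notin> G \<Longrightarrow> dim G \<le> dim Z"
    using ex_max_dim[of "\<lambda>G. subspace G \<and> V \<subseteq> G \<and> y \<notin> G" V] assms by blast
  have sZ: "span Z = Z"
    using Z by simp
  have "w \<in> span (insert y Z)" for w
  proof (cases "w \<in> Z")
    case False
    then have "\<not> dim (span (insert w Z)) \<le> dim Z"
      by (simp add: dim_insert sZ)
    moreover have "V \<subseteq> span (insert w Z)"
      using Z(2) span_superset[of "insert w Z"] by blast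
    ultimately have "y \<in> span (insert w Z)"
      using max[of "span (insert w Z)"] by auto
    then show ?thesis
      using in_span_insert[of y w Z] Z sZ by simp
  qed (simp add: span_base)
  then have "dim UNIV = dim (insert y Z)"
    using dim_span[of "insert y Z"] by (metis UNIV_eq_I)
  then have "codim1_in Z UNIV"
    using Z sZ by (simp add: codim1_in_def dim_insert)
  then show ?thesis
    using that Z by blast
qed

text \<open>\<open>A + Z\<close> is strictly larger than the hyperplane \<open>Z\<close>, hence of
  full dimension; the modular law for dimensions gives the rest.\<close>

lemma dim_hyperplane_Int:
  assumes "codim1_in Z UNIV" "subspace A" "\<not> A \<subseteq> Z"
  shows "dim A = dim (A \<inter> Z) + 1"
proof -
  have Z: "subspace Z" "dim UNIV = dim Z + 1"
    using assms by (auto simp: codim1_in_def)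
  have "Z \<noteq> A + Z"
    using assms subset_plus_left[OF Z(1), of A] by blast
  then have "dim Z < dim (A + Z)"
    using subspace_dim_equal[OF Z(1) subspace_plus[OF assms(2) Z(1)] subset_plus_right[OF assms(2)]]
    by force
  moreover have "dim (A + Z) \<le> dim UNIV"
    by (rule dim_subset[OF subset_UNIV])
  ultimately show ?thesis
    using dim_plus_Int[OF assms(2) Z(1)] Z by linarith
qed

section \<open>Nullity, closure and rank increments under strong maps\<close>

lemma q_matroid_nullity_mono:
  assumes r: "q_matroid r" and "subspace A" "subspace B" "A \<subseteq> B"
  shows "int (dim A) - r A \<le> int (dim B) - r B"
proof (rule subspace_chain_mono[of "\<lambda>A. int (dim A) - r A"])
  fix C z assume C: "subspace C" and z: "line z" "\<not> z \<subseteq> C"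
  have sz: "subspace z" "dim z = 1"
    using z by (auto simp: line_def)
  \<comment> \<open>Adding a line raises the rank by at most \<open>r z\<close>, hence by at most 1,
    while the dimension grows by exactly 1.\<close>
  have "r (C + z) + r (C \<inter> z) \<le> r C + r z"
    using q_matroid_submodular[OF r C sz(1)] .
  moreover have "0 \<le> r (C \<inter> z)" "r z \<le> 1"
    using q_matroid_bounds(1)[OF r, of "C \<inter> z"] q_matroid_bounds(2)[OF r, of z] C sz
    by (simp_all add: subspace_inter)
  ultimately show "int (dim C) - r C \<le> int (dim (C + z)) - r (C + z)"
    using dim_plus_line[OF C z] by simp
qed (use assms in auto)

text \<open>Independence means nullity 0, and nullity is nonnegative and monotone.\<close>

lemma q_independent_subset:
  assumes "q_matroid r" "q_independent r B" "subspace A" "A \<subseteq> B"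
  shows "q_independent r A"
  using q_matroid_nullity_mono[OF assms(1,3) _ assms(4)] q_matroid_bounds(2)[OF assms(1,3)] assms
  by (auto simp: q_independent_def)

text \<open>\<open>F\<close> has the greatest dimension among the subspaces above \<open>A\<close>
  of the same rank; a line outside \<open>F\<close> that kept the rank would enlarge it.\<close>

lemma q_flat_closure_ex:
  assumes r: "q_matroid r" and A: "subspace A"
  obtains F where "q_flat r F" "A \<subseteq> F" "r F = r A"
proof -
  obtain F where F: "subspace F" "A \<subseteq> F" "r F = r A"
    and max: "\<And>G. subspace G \<and> A \<subseteq> G \<and> r G = r A \<Longrightarrow> dim G \<le> dim F"
    using ex_max_dim[of "\<lambda>G. subspace G \<and> A \<subseteq> G \<and> r G = r A" A] A by blast
  have "r F < r (F + z)" if z: "line z" "\<not> z \<subseteq> F" for z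
  proof (rule ccontr)
    assume not: "\<not> r F < r (F + z)"
    have sz: "subspace z"
      using z by (simp add: line_def)
    have *: "subspace (F + z)" "F \<subseteq> F + z"
      using F sz by (simp_all add: subspace_plus subset_plus_left)
    then have "r (F + z) = r A"
      using q_matroid_mono[OF r F(1) *] not F by simp
    then have "dim (F + z) \<le> dim F"
      using max * F by blast
    then show False
      using dim_plus_line[OF F(1) z] by simp
  qed
  then show ?thesis
    using that F by (auto simp: q_flat_def)
qed

text \<open>For one added line \<open>z\<close>, let \<open>F\<close> be the closure of
  \<open>C\<close> under \<open>r2\<close>. If \<open>z\<close> lies in \<open>F\<close>, then
  \<open>r2\<close> does not grow. Otherwise \<open>F\<close> is also a flat for \<open>r1\<close>,
  so \<open>r1\<close> grows at \<open>F\<close> and, by diminishing increments, at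
  \<open>C\<close>, while \<open>r2\<close> grows by at most 1.\<close>

lemma strong_map_rank_diff:
  assumes r1: "q_matroid r1" and r2: "q_matroid r2" and strong: "id_strong_map r1 r2"
    and "subspace A" "subspace B" "A \<subseteq> B"
  shows "r2 B - r2 A \<le> r1 B - r1 A"
proof -
  have "r1 A - r2 A \<le> r1 B - r2 B"
  proof (rule subspace_chain_mono[of "\<lambda>A. r1 A - r2 A"])
    fix C z assume C: "subspace C" and z: "line z" "\<not> z \<subseteq> C"
    have sz: "subspace z"
      using z by (simp add: line_def)
    have Cz: "subspace (C + z)" "C \<subseteq> C + z"
      using C sz by (simp_all add: subspace_plus subset_plus_left)
    have mono1: "r1 C \<le> r1 (C + z)"
      using q_matroid_mono[OF r1 C Cz] .
    have inc: "r2 (C + z) \<le> r2 C + 1"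
      using q_matroid_nullity_mono[OF r2 C Cz] dim_plus_line[OF C z] by simp
    obtain F where F: "q_flat r2 F" "C \<subseteq> F" "r2 F = r2 C"
      using q_flat_closure_ex[OF r2 C] .
    have sF: "subspace F"
      using F by (simp add: q_flat_def)
    show "r1 C - r2 C \<le> r1 (C + z) - r2 (C + z)"
    proof (cases "z \<subseteq> F")
      case True
      have "r2 (C + z) \<le> r2 F"
        using q_matroid_mono[OF r2 Cz(1) sF plus_subset_subspace[OF sF F(2) True]] .
      then show ?thesis
        using F mono1 by simp
    next
      case False
      have "q_flat r1 F"
        using strong F by (simp add: id_strong_map_def)
      then have "r1 (F + z) > r1 F"
        using z False by (simp add: q_flat_def)
      then show ?thesis
        using q_matroid_increment_antimono[OF r1 C sF sz F(2)] inc by simp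
    qed
  qed (use assms in auto)
  then show ?thesis by simp
qed

section \<open>Bases and circuits\<close>

lemma q_matroid_basis_ex:
  assumes r: "q_matroid r"
  obtains X where "q_independent r X" "r X = r UNIV"
proof -
  have "r {0} = 0"
    using q_matroid_bounds[OF r subspace_single_0] by simp
  then have "q_independent r {0}"
    by (simp add: q_independent_def)
  then obtain X where X: "q_independent r X" and max: "\<And>G. q_independent r G \<Longrightarrow> dim G \<le> dim X"
    using ex_max_dim[of "q_independent r"] by blast
  have sX: "subspace X" and rX: "r X = int (dim X)"
    using X by (auto simp: q_independent_def)
  obtain F where F: "q_flat r F" "X \<subseteq> F" "r F = r X"
    using q_flat_closure_ex[OF r sX] .
  have sF: "subspace F"
    using F by (simp add: q_flat_def)
  \<comment> \<open>A point outside the closure \<open>F\<close> raises the rank at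
    \<open>F\<close>, hence at \<open>X\<close>, and so yields an independent subspace larger than
    the maximal \<open>X\<close>.\<close>
  have "x \<in> F" for x
  proof (rule ccontr)
    assume x: "x \<notin> F"
    then have z: "line (span {x})" "\<not> span {x} \<subseteq> F" "subspace (span {x})"
      using sF subspace_0 span_base[of x "{x}"] by (auto intro!: line_span_singleton)
    then have "r F < r (F + span {x})"
      using F by (simp add: q_flat_def)
    then have "r X < r (X + span {x})"
      using q_matroid_increment_antimono[OF r sX sF z(3) F(2)] by simp
    moreover have d: "dim (X + span {x}) = dim X + 1"
      using dim_plus_line[OF sX z(1)] z F by blast
    moreover have s: "subspace (X + span {x})"
      using sX by (simp add: subspace_plus)
    ultimately have "q_independent r (X + span {x})"
      using q_matroid_bounds(2)[OF r s] rX by (simp add: q_independent_def)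
    then show False
      using max d by fastforce
  qed
  then have "F = UNIV" by blast
  then show ?thesis
    using that X F by simp
qed

text \<open>\<open>D\<close> is a dependent subspace of \<open>A\<close> of least dimension. For a
  rank function bounded by \<open>dim\<close>, the last clause says that proper subspaces of
  \<open>D\<close> are independent.\<close>

lemma ex_circuit:
  assumes "subspace A" "r A < int (dim A)"
  obtains D where "subspace D" "D \<subseteq> A" "r D < int (dim D)"
    "\<And>G. subspace G \<Longrightarrow> G \<subset> D \<Longrightarrow> int (dim G) \<le> r G"
proof -
  define P where "P G \<longleftrightarrow> subspace G \<and> G \<subseteq> A \<and> r G < int (dim G)" for G
  have "P A"
    using assms by (simp add: P_def)
  then obtain D where D: "P D" and min: "\<And>G. P G \<Longrightarrow> dim D \<le> dim G"
    using ex_has_least_nat[of P A dim] by metis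
  have "int (dim G) \<le> r G" if G: "subspace G" "G \<subset> D" for G
  proof (rule ccontr)
    assume "\<not> int (dim G) \<le> r G"
    then have "dim D \<le> dim G"
      using G D min[of G] by (auto simp: P_def)
    then show False
      using subspace_dim_equal[OF G(1), of D] G D by (auto simp: P_def)
  qed
  with D show ?thesis
    using that by (auto simp: P_def)
qed

section \<open>The exchange axioms and non-emptiness\<close>

lemma q_g_matroid_delta_F1:
  assumes r1: "q_matroid r1" and r2: "q_matroid r2" and strong: "id_strong_map r1 r2"
  shows "q_delta_F1 {A. q_independent r1 A \<and> q_spanning r2 A}" (is "q_delta_F1 ?F")
  unfolding q_delta_F1_def
proof (intro ballI allI impI)
  fix X Y A assume X: "X \<in> ?F" and Y: "Y \<in> ?F" and AX: "codim1_in A X"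
  have sub: "subspace A" "subspace X" "subspace Y" "A \<subseteq> X" "dim X = dim A + 1"
    using AX Y by (auto simp: codim1_in_def q_independent_def)
  have indA: "q_independent r1 A"
    using q_independent_subset[OF r1 _ sub(1,4)] X by blast
  show "(\<exists>Z. codim1_in Z UNIV \<and> A \<subseteq> Z \<and> \<not> Y \<subseteq> Z \<and>
           (\<forall>z. line z \<longrightarrow> \<not> z \<subseteq> Z \<longrightarrow> A + z \<in> ?F)) \<or>
        (\<exists>Z. codim1_in Z UNIV \<and> Z \<inter> A \<in> ?F)"
  proof (cases "r2 A = r2 UNIV")
    case True
    \<comment> \<open>Here \<open>A\<close> is itself feasible, and (ii) holds with any hyperplane
      containing \<open>A\<close>; one exists because \<open>A\<close> is proper.\<close>
    have "A \<noteq> X"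
      using sub by auto
    then obtain y where "y \<notin> A"
      using sub by blast
    then obtain Z where "codim1_in Z UNIV" "A \<subseteq> Z"
      using ex_hyperplane_avoiding[OF sub(1)] by blast
    moreover have "A \<in> ?F"
      using True indA sub by (simp add: q_spanning_def)
    ultimately show ?thesis
      by (metis inf.absorb2)
  next
    case False
    have "r2 X = r2 UNIV" "r2 Y = r2 UNIV"
      using X Y by (auto simp: q_spanning_def)
    \<comment> \<open>Passing from the spanning \<open>X\<close> to codimension 1 loses at most one
      unit of rank, so \<open>A\<close> is exactly one short of spanning.\<close>
    then have rA: "r2 A \<ge> r2 UNIV - 1" "r2 A < r2 UNIV"
      using q_matroid_nullity_mono[OF r2 sub(1,2,4)] sub(5)
        q_matroid_mono[OF r2 sub(1) subspace_UNIV] False by auto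
    obtain F where F: "q_flat r2 F" "A \<subseteq> F" "r2 F = r2 A"
      using q_flat_closure_ex[OF r2 sub(1)] .
    have sF: "subspace F"
      using F by (simp add: q_flat_def)
    have "\<not> Y \<subseteq> F"
      using q_matroid_mono[OF r2 sub(3) sF] F rA \<open>r2 Y = _\<close> by auto
    then obtain y where y: "y \<in> Y" "y \<notin> F" by blast
    obtain Z where Z: "codim1_in Z UNIV" "F \<subseteq> Z" "y \<notin> Z"
      using ex_hyperplane_avoiding[OF sF y(2)] .
    have "A + z \<in> ?F" if z: "line z" "\<not> z \<subseteq> Z" for z
    proof -
      have sz: "subspace z"
        using z by (simp add: line_def)
      have Az: "subspace (A + z)" "A \<subseteq> A + z"
        using sub sz by (simp_all add: subspace_plus subset_plus_left)
      have zF: "\<not> z \<subseteq> F" "\<not> z \<subseteq> A"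
        using z Z F by blast+
      \<comment> \<open>A line outside \<open>Z\<close> is outside the flat \<open>F\<close>; the
        rank gained at \<open>F\<close> is gained at \<open>A\<close> too, which makes
        \<open>A + z\<close> spanning.\<close>
      have "r2 F < r2 (F + z)"
        using F z zF by (simp add: q_flat_def)
      then have inc: "r2 A < r2 (A + z)"
        using q_matroid_increment_antimono[OF r2 sub(1) sF sz F(2)] by simp
      then have "r2 (A + z) = r2 UNIV"
        using rA q_matroid_mono[OF r2 Az(1) subspace_UNIV] by simp
      \<comment> \<open>The strong map carries the increase of \<open>r2\<close> over to
        \<open>r1\<close>, so adding \<open>z\<close> keeps the independence of
        \<open>A\<close>.\<close>
      moreover have "r1 A < r1 (A + z)"
        using strong_map_rank_diff[OF r1 r2 strong sub(1) Az] inc by simp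
      then have "r1 (A + z) = int (dim (A + z))"
        using q_matroid_bounds(2)[OF r1 Az(1)] dim_plus_line[OF sub(1) z(1) zF(2)] indA
        by (simp add: q_independent_def)
      ultimately show ?thesis
        using Az by (simp add: q_independent_def q_spanning_def)
    qed
    then show ?thesis
      using Z F y by blast
  qed
qed

lemma q_g_matroid_delta_F2:
  assumes r1: "q_matroid r1" and r2: "q_matroid r2" and strong: "id_strong_map r1 r2"
  shows "q_delta_F2 {A. q_independent r1 A \<and> q_spanning r2 A}" (is "q_delta_F2 ?F")
  unfolding q_delta_F2_def
proof (intro ballI allI impI)
  fix X Y A assume X: "X \<in> ?F" and Y: "Y \<in> ?F" and XA: "codim1_in X A"
  have sub: "subspace X" "subspace A" "subspace Y" "X \<subseteq> A" "dim A = dim X + 1"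
    using XA Y by (auto simp: codim1_in_def q_independent_def)
  have spanA: "r2 A = r2 UNIV"
    using q_matroid_mono[OF r2 sub(1,2,4)] q_matroid_mono[OF r2 sub(2) subspace_UNIV] X
    by (simp add: q_spanning_def)
  show "(\<exists>z. line z \<and> z \<subseteq> A \<and> \<not> z \<subseteq> Y \<and>
           (\<forall>Z. codim1_in Z UNIV \<longrightarrow> \<not> z \<subseteq> Z \<longrightarrow> A \<inter> Z \<in> ?F)) \<or>
        (\<exists>z. line z \<and> A + z \<in> ?F)"
  proof (cases "r1 A = int (dim A)")
    case True
    \<comment> \<open>Here \<open>A\<close> is itself feasible, and (iv) holds with any line inside
      \<open>A\<close>, since then \<open>A + z = A\<close>.\<close>
    have "\<not> A \<subseteq> {0}"
      using sub(5) dim_eq_0[of A] by simp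
    then obtain x where x: "x \<in> A" "x \<noteq> 0" by blast
    then have "line (span {x})" "A + span {x} = A"
      using sub by (simp_all add: line_span_singleton plus_absorb span_minimal)
    moreover have "A \<in> ?F"
      using True sub spanA by (simp add: q_independent_def q_spanning_def)
    ultimately show ?thesis
      by metis
  next
    case False
    then have dep: "r1 A < int (dim A)"
      using q_matroid_bounds(2)[OF r1 sub(2)] by simp
    have rA: "r1 A = int (dim A) - 1"
      using q_matroid_mono[OF r1 sub(1,2,4)] X sub(5) dep by (simp add: q_independent_def)
    obtain D where D: "subspace D" "D \<subseteq> A" "r1 D < int (dim D)"
      and min: "\<And>G. subspace G \<Longrightarrow> G \<subset> D \<Longrightarrow> int (dim G) \<le> r1 G"
      using ex_circuit[of A r1] sub(2) dep by metis
    \<comment> \<open>Subspaces of the independent \<open>Y\<close> are independent, but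
      \<open>D\<close> is dependent.\<close>
    have "\<not> D \<subseteq> Y"
      using q_independent_subset[OF r1 _ D(1), of Y] Y D by (auto simp: q_independent_def)
    then obtain y where y: "y \<in> D" "y \<notin> Y" by blast
    have "A \<inter> Z \<in> ?F" if Z: "codim1_in Z UNIV" "\<not> span {y} \<subseteq> Z" for Z
    proof -
      have sZ: "subspace Z"
        using Z by (simp add: codim1_in_def)
      have yZ: "y \<notin> Z"
        using Z sZ span_minimal[of "{y}" Z] by auto
      define H where "H = A \<inter> Z"
      have sH: "subspace H" "H \<subseteq> A"
        using sub sZ by (auto simp: H_def subspace_inter)
      have dH: "dim A = dim H + 1"
        unfolding H_def using dim_hyperplane_Int[OF Z(1) sub(2)] yZ y D by blast
      have DH: "D + H \<subseteq> A"
        using plus_subset_subspace[OF sub(2) D(2) sH(2)] .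
      have DHi: "D \<inter> H = D \<inter> Z"
        using D by (auto simp: H_def)
      have dD: "dim D = dim (D \<inter> H) + 1"
        unfolding DHi using dim_hyperplane_Int[OF Z(1) D(1)] yZ y by blast
      \<comment> \<open>Cutting with \<open>Z\<close> lowers the dimension of both \<open>A\<close>
        and \<open>D\<close> by 1, so \<open>D + H\<close> has the dimension of
        \<open>A\<close>.\<close>
      have "D + H = A"
        using dim_plus_Int[OF D(1) sH(1)] dD dH
        by (intro subspace_dim_equal[OF subspace_plus[OF D(1) sH(1)] sub(2) DH]) simp
      then have "r1 A + r1 (D \<inter> H) \<le> r1 D + r1 H"
        using q_matroid_submodular[OF r1 D(1) sH(1)] by simp
      \<comment> \<open>\<open>D \<inter> H\<close> misses \<open>y\<close>, so it is a proper
        subspace of the circuit and independent. Since \<open>A\<close> has nullity 1 and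
        \<open>D\<close> nullity at least 1, submodularity leaves nullity 0 for
        \<open>H\<close>.\<close>
      moreover have "int (dim (D \<inter> H)) \<le> r1 (D \<inter> H)"
        using D sH y yZ by (intro min) (auto simp: subspace_inter H_def)
      ultimately have rH: "r1 H = int (dim H)"
        using D(3) dD rA dH q_matroid_bounds(2)[OF r1 sH(1)] by simp
      \<comment> \<open>\<open>r1 A\<close> and \<open>r1 H\<close> both equal \<open>dim H\<close>,
        so the strong map allows no loss of \<open>r2\<close> from \<open>A\<close> to
        \<open>H\<close>.\<close>
      then have "r2 A \<le> r2 H"
        using strong_map_rank_diff[OF r1 r2 strong sH(1) sub(2) sH(2)] rA dH by simp
      then have "r2 H = r2 UNIV"
        using q_matroid_mono[OF r2 sH(1) subspace_UNIV] spanA by simp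
      then show ?thesis
        using rH sH(1) by (simp add: q_independent_def q_spanning_def H_def)
    qed
    moreover have "line (span {y})"
      using y sub(3) subspace_0 by (intro line_span_singleton) auto
    moreover have "span {y} \<subseteq> A" "\<not> span {y} \<subseteq> Y"
      using y D sub span_base[of y "{y}"] span_minimal[of "{y}" A] by auto
    ultimately show ?thesis
      by blast
  qed
qed

lemma q_g_matroid_imp_q_delta_matroid:
  assumes "q_g_matroid \<F>"
  shows "q_delta_matroid \<F>"
proof -
  obtain r1 r2 where r: "q_matroid r1" "q_matroid r2" "id_strong_map r1 r2"
    and \<F>: "\<F> = {A. q_independent r1 A \<and> q_spanning r2 A}"
    using assms unfolding q_g_matroid_def by blast
  obtain X where X: "q_independent r1 X" "r1 X = r1 UNIV"
    using q_matroid_basis_ex[OF r(1)] .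
  then have sX: "subspace X"
    by (simp add: q_independent_def)
  \<comment> \<open>A basis for \<open>r1\<close> is feasible: no increase of \<open>r1\<close>
    remains above \<open>X\<close>, hence none of \<open>r2\<close>.\<close>
  have "r2 X = r2 UNIV"
    using strong_map_rank_diff[OF r sX subspace_UNIV] X
      q_matroid_mono[OF r(2) sX subspace_UNIV] by simp
  then have "X \<in> \<F>"
    using X sX by (simp add: \<F> q_spanning_def)
  then show ?thesis
    using q_g_matroid_delta_F1[OF r] q_g_matroid_delta_F2[OF r]
    unfolding q_delta_matroid_def \<F> by (auto simp: q_independent_def)
qed

end

theorem theorem4p12:
  fixes scale :: "'a::field \<Rightarrow> 'b::ab_group_add \<Rightarrow> 'b"
    and Basis :: "'b set"
    and \<F> :: "'b set set"
  assumes "finite_dimensional_vector_space scale Basis"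
    and "vector_space.q_g_matroid scale \<F>"
  shows "vector_space.q_delta_matroid scale \<F>"
  using finite_dimensional_vector_space.q_g_matroid_imp_q_delta_matroid[OF assms] .

end
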